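(* Let $p>q$ be relatively prime positive integers and $0<k<p$. Let $\theta=p/\gcd(p,k)$ be the order of $k\pmod p$, and let $r_i$ and $d_i$ be the remainders and coefficients of the Euclidean algorithm applied to $(p,q)$. The number of times the sequence $S(p,q,k)$ achieves its minimum is $$\prod_{0<j<n,\ \theta\mid r_j}\lceil r_{j-1}/r_j\rceil=\prod_{0<j<n,\ \theta\mid r_j}(d_{j+1}+1).$$ In particular, the minimum is attained uniquely if and only if $\theta$ is not a harmonic of the pair $(p,q)$.
   Context: Euclidean algorithm: put $r_{-1}=p$, $r_0=q$, and write $r_{i-2}=d_i r_{i-1}+r_i$ with $0\le r_i<r_{i-1}$ for $i=1,\dots,n$, where $r_n=0$ is the first zero value (so $r_{n-1}=1$). The remainders are $r_1>\cdots>r_{n-1}=1$ and the coefficients are $d_1,\dots,d_n$. A harmonic of $(p,q)$ is a common divisor of $p$ and one of the remainders $r_1,\dots,r_{n-1}$. The empty product equals $1$. Sequence: $[a]_p\in\{0,\dots,p-1\}$ denotes the residue of $a$ mod $p$. Let $q'$ be the smallest positive integer with $q'q\equiv1\pmod p$, $l=[q'k]_p$, $t=l/\gcd(p,l)=l\theta/p$, and $S=\{[q]_p,[2q]_p,\dots,[lq]_p\}\subset\{1,\dots,p-1\}$. Let $g:\{0,\dots,p-1\}\to\mathbb{Z}$ be the unique function with $\min(g)=0$ and, for $0<x<p$, $g(x)-g(x-1)=t$ if $x\notin S$ and $g(x)-g(x-1)=t-\theta$ if $x\in S$. Then $S(p,q,k)$ is the sequence $g(0),\dots,g(p-1)$;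 the number of times it achieves its minimum is the number of $x\in\{0,\dots,p-1\}$ with $g(x)=0$. *)

theory Defs
  imports Complex_Main "HOL-Library.FuncSet" "HOL-Number_Theory.Cong"
begin

text \<open>
  The remainder \<open>r\<^sub>i\<close> for \<open>i \<ge> 0\<close>. The value \<open>r\<^sub>-\<^sub>1 = p\<close> only enters through the second equation.
  Values beyond the first zero are junk, since \<open>x mod 0 = x\<close>.
\<close>

fun euclid_rem :: "nat \<Rightarrow> nat \<Rightarrow> nat \<Rightarrow> nat" where
  "euclid_rem p q 0 = q"
| "euclid_rem p q (Suc 0) = p mod q"
| "euclid_rem p q (Suc (Suc i)) = euclid_rem p q i mod euclid_rem p q (Suc i)"

text \<open>
  The coefficient \<open>d\<^sub>i\<close>, the quotient in \<open>r\<^sub>i\<^sub>-\<^sub>2 = d\<^sub>i r\<^sub>i\<^sub>-\<^sub>1 + r\<^sub>i\<close>, for \<open>1 \<le> i \<le> n\<close>;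
  there is no \<open>d\<^sub>0\<close>, and its value here is a dummy.
\<close>

fun euclid_coeff :: "nat \<Rightarrow> nat \<Rightarrow> nat \<Rightarrow> nat" where
  "euclid_coeff p q 0 = 0"
| "euclid_coeff p q (Suc 0) = p div q"
| "euclid_coeff p q (Suc (Suc i)) = euclid_rem p q i div euclid_rem p q (Suc i)"

definition euclid_len :: "nat \<Rightarrow> nat \<Rightarrow> nat" where
  "euclid_len p q = (LEAST n. euclid_rem p q n = 0)"

definition harmonic :: "nat \<Rightarrow> nat \<Rightarrow> nat \<Rightarrow> bool" where
  "harmonic p q h \<longleftrightarrow> h dvd p \<and> (\<exists>i. 0 < i \<and> i < euclid_len p q \<and> h dvd euclid_rem p q i)"

definition theta :: "nat \<Rightarrow> nat \<Rightarrow> nat" where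
  "theta p k = p div gcd p k"

definition inv_mod :: "nat \<Rightarrow> nat \<Rightarrow> nat" where
  "inv_mod p q = (LEAST a. 0 < a \<and> [a * q = 1] (mod p))"

definition seq_l :: "nat \<Rightarrow> nat \<Rightarrow> nat \<Rightarrow> nat" where
  "seq_l p q k = (inv_mod p q * k) mod p"

definition seq_t :: "nat \<Rightarrow> nat \<Rightarrow> nat \<Rightarrow> nat" where
  "seq_t p q k = seq_l p q k div gcd p (seq_l p q k)"

definition seq_steps :: "nat \<Rightarrow> nat \<Rightarrow> nat \<Rightarrow> nat set" where
  "seq_steps p q k = (\<lambda>i. (i * q) mod p) ` {1..seq_l p q k}"

text \<open>
  A function on \<open>{0,\<dots>,p-1}\<close> is a total function that is \<^const>\<open>undefined\<close> outside
  this set, so that uniqueness of the sequence makes sense.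
\<close>

definition is_seq :: "nat \<Rightarrow> nat \<Rightarrow> nat \<Rightarrow> (nat \<Rightarrow> int) \<Rightarrow> bool" where
  "is_seq p q k g \<longleftrightarrow> g \<in> extensional {..<p} \<and> Min (g ` {..<p}) = 0 \<and>
     (\<forall>x. 0 < x \<and> x < p \<longrightarrow> g x - g (x - 1) =
        (if x \<in> seq_steps p q k then int (seq_t p q k) - int (theta p k)
         else int (seq_t p q k)))"

definition S_seq :: "nat \<Rightarrow> nat \<Rightarrow> nat \<Rightarrow> nat \<Rightarrow> int" where
  "S_seq p q k = (THE g. is_seq p q k g)"

definition min_count :: "nat \<Rightarrow> nat \<Rightarrow> nat \<Rightarrow> nat" where
  "min_count p q k = card {x. x < p \<and> S_seq p q k x = 0}"

lemma Min_shift: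
  fixes h :: "nat \<Rightarrow> int"
  assumes "0 < p"
  shows "Min ((\<lambda>x. h x + c) ` {..<p}) = Min (h ` {..<p}) + c"
  using assms Min_add_commute[of "{..<p}" h c] by auto

lemma ex1_is_seq:
  assumes p: "0 < p"
  shows "\<exists>!g. is_seq p q k g"
proof
  define D where "D x = (if x \<in> seq_steps p q k then int (seq_t p q k) - int (theta p k)
         else int (seq_t p q k))" for x
  define h where "h x = (\<Sum>y\<in>{1..x}. D y)" for x
  define m where "m = Min (h ` {..<p})"
  let ?g = "restrict (\<lambda>x. h x + (- m)) {..<p}"
  have "?g ` {..<p} = (\<lambda>x. h x + (- m)) ` {..<p}" by simp
  then have "Min (?g ` {..<p}) = 0"
    using Min_shift[OF p, of h "- m"] by (simp add: m_def)
  moreover have "h x - h (x - 1) = D x" if "0 < x" for x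
    using that by (cases x) (simp_all add: h_def)
  ultimately show ex: "is_seq p q k ?g"
    unfolding is_seq_def D_def[symmetric] by auto
  fix f assume f: "is_seq p q k f"
  have step: "f (Suc x) - f x = D (Suc x)" if "Suc x < p" for x
  proof -
    have "\<forall>x. 0 < x \<and> x < p \<longrightarrow> f x - f (x - 1) = D x"
      using f unfolding is_seq_def D_def by blast
    from this[rule_format, of "Suc x"] show ?thesis using that by simp
  qed
  have fh: "f x = h x + f 0" if "x < p" for x
    using that
  proof (induction x)
    case (Suc x)
    then show ?case using step[of x] by (simp add: h_def)
  qed (simp add: h_def)
  have "f ` {..<p} = (\<lambda>x. h x + f 0) ` {..<p}"
  proof (rule image_cong[OF refl])
    fix x assume "x \<in> {..<p}"
    then show "f x = h x + f 0" by (intro fh) simp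
  qed
  then have f0: "f 0 = - m"
    using f Min_shift[OF p, of h "f 0"] by (simp add: is_seq_def m_def)
  then show "f = ?g"
  proof (intro ext)
    fix x
    show "f x = ?g x"
    proof (cases "x < p")
      case True
      then show ?thesis using fh[OF True] unfolding f0 by simp
    next
      case False
      then show ?thesis using f by (simp add: is_seq_def extensional_def)
    qed
  qed
qed

end

theory Submission
  imports Defs
begin

text \<open>
  Write \<open>g\<close> for the sequence, \<open>h\<close> for \<open>\<theta>\<close> and \<open>s = k / gcd(p, k)\<close>, so that \<open>s p = h k\<close>.
  The sequence is defined by its steps of length 1, but its steps of length \<open>q\<close> are simpler:
  the difference \<open>g(x + q) - g(x)\<close> changes only where the arithmetic progression \<open>S\<close> begins or
  ends, that is at \<open>0\<close> and at \<open>l q = k\<close>, which gives \<open>g(x + q) - g(x) = s - h [x < k]\<close>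
  with \<open>x + q\<close> read modulo \<open>p\<close> (\<open>S_seq_q_step\<close>). So \<open>g\<close> is a potential along the rotation by \<open>q\<close> of \<open>{0, ..., p - 1}\<close>. Negating
  and translating by \<open>k\<close> turns its minima into the maxima of a potential of the same kind, with
  \<open>h - s\<close> and \<open>p - k\<close> in place of \<open>s\<close> and \<open>k\<close>.

  More generally, consider potentials \<open>F\<close> on \<open>{0, ..., P - 1}\<close> whose increment along the rotation
  by \<open>Q\<close> is \<open>A - h [x < k]\<close>, plus \<open>B\<close> whenever the rotation wraps around (\<open>up_walk\<close>), or the
  same along the rotation by \<open>-Q\<close> (\<open>down_walk\<close>). Since the increments along the single orbit add
  up to zero, \<open>A P + B Q = h k\<close>. Cut \<open>{0, ..., P - 1}\<close> into columns, the residue classes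
  modulo \<open>Q\<close>, each of length \<open>\<lfloor>P/Q\<rfloor>\<close> or \<open>\<lfloor>P/Q\<rfloor> + 1\<close>. If \<open>A \<noteq> 0\<close>, the sign pattern of the
  increments confines every maximum to one interval of length \<open>Q\<close>: the bottom \<open>[0, Q)\<close>, the top
  \<open>[P - Q, P)\<close>, or \<open>[k - Q, k)\<close>. The first return to this interval is, after reflecting it if
  necessary, again a walk of one of the two kinds, for the rotation by \<open>P mod Q\<close> on \<open>Q\<close> points.
  This is one step of the Euclidean algorithm, and the number of maxima does not change.

  If \<open>A = 0\<close>, the potential is constant on columns and the maximal columns all have the greater
  length, so the step multiplies the number of maxima by \<open>\<lfloor>P/Q\<rfloor> + 1\<close>. Because \<open>A\<close>, \<open>B\<close>, \<open>h\<close> have no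
  common factor, \<open>P\<close> and \<open>Q\<close> are coprime and \<open>\<bar>A\<bar> < h\<close>, the relation \<open>A P + B Q = h k\<close> shows that
  \<open>A = 0\<close> happens exactly if \<open>h\<close> divides \<open>Q\<close>. As \<open>Q\<close> runs through the remainders \<open>r\<^sub>j\<close>, this
  yields the factor \<open>d\<^sub>j\<^sub>+\<^sub>1 + 1\<close> exactly at those \<open>j\<close> with \<open>h\<close> dividing \<open>r\<^sub>j\<close>
  (\<open>card_maximizers_walk\<close>).
  For \<open>j = 0\<close> this cannot occur, since \<open>h > 1\<close> divides \<open>p\<close>, which is coprime to \<open>q\<close>.
  All factors are at least 2, so uniqueness means that there is none.
\<close>

section \<open>Walks along a rotation and their maximizers\<close>

text \<open>
  The rotation by \<open>Q\<close> is written as two translations, \<open>[0, P - Q)\<close> to \<open>[Q, P)\<close> and \<open>[P - Q, P)\<close>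
  to \<open>[0, Q)\<close>; the second clause is indexed by the image point, so that neither point has to be
  written as a difference.
\<close>
definition up_walk :: "int \<Rightarrow> nat \<Rightarrow> nat \<Rightarrow> int \<Rightarrow> int \<Rightarrow> nat \<Rightarrow> (nat \<Rightarrow> int) \<Rightarrow> bool" where
  "up_walk h P Q A B k F \<longleftrightarrow>
     (\<forall>x < P - Q. F (x + Q) = F x + A - h * of_bool (x < k)) \<and>
     (\<forall>x < Q. F x = F (x + (P - Q)) + A + B - h * of_bool (x + (P - Q) < k))"

text \<open>
  The increments belong to the inverse rotation: in the first clause the walk moves from \<open>x + Q\<close>
  down to \<open>x\<close>, in the second it wraps from \<open>x\<close> up to \<open>x + (P - Q)\<close>. The indicator \<open>[\<dots> < k]\<close> is
  always evaluated at the starting point.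
\<close>
definition down_walk :: "int \<Rightarrow> nat \<Rightarrow> nat \<Rightarrow> int \<Rightarrow> int \<Rightarrow> nat \<Rightarrow> (nat \<Rightarrow> int) \<Rightarrow> bool" where
  "down_walk h P Q A B k F \<longleftrightarrow>
     (\<forall>x < P - Q. F x = F (x + Q) + A - h * of_bool (x + Q < k)) \<and>
     (\<forall>x < Q. F (x + (P - Q)) = F x + A + B - h * of_bool (x < k))"

definition maximizers :: "nat \<Rightarrow> (nat \<Rightarrow> int) \<Rightarrow> nat set" where
  "maximizers P F = {x. x < P \<and> (\<forall>y<P. F y \<le> F x)}"

text \<open>
  All maximizers lie in the image of \<open>pos\<close> because every other point is beaten by some point; since
  a maximum over a finite set exists, being maximal on the image is then as good as being maximal.
\<close>
lemma maximizers_restrict: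
  assumes "\<And>x. x < P \<Longrightarrow> x \<notin> pos ` {..<Q} \<Longrightarrow> \<exists>y<P. F x < F y"
    and "pos ` {..<Q} \<subseteq> {..<P}"
  shows "maximizers P F = pos ` maximizers Q (F \<circ> pos)"
proof -
  have sub: "maximizers P F \<subseteq> pos ` {..<Q}"
    using assms(1) unfolding maximizers_def by (force simp: not_le[symmetric])
  show ?thesis
  proof (intro equalityI subsetI)
    fix x assume x: "x \<in> maximizers P F"
    then obtain w where w: "w < Q" "x = pos w" using sub by auto
    have "w \<in> maximizers Q (F \<circ> pos)"
      using x w assms(2) by (auto simp: maximizers_def)
    then show "x \<in> pos ` maximizers Q (F \<circ> pos)" using w by auto
  next
    fix x assume "x \<in> pos ` maximizers Q (F \<circ> pos)"
    then obtain w where w: "w \<in> maximizers Q (F \<circ> pos)" "x = pos w" by auto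
    have wQ: "w < Q" using w by (simp add: maximizers_def)
    then have xP: "x < P" using w assms(2) by auto
    let ?M = "Max (F ` {..<P})"
    have "?M \<in> F ` {..<P}" using xP by (intro Max_in) auto
    then obtain y where y: "y < P" "F y = ?M" by auto
    have "y \<in> maximizers P F" using y by (simp add: maximizers_def)
    then obtain v where v: "v < Q" "y = pos v" using sub by auto
    then have "F y \<le> F x" using w by (auto simp: maximizers_def)
    then show "x \<in> maximizers P F" using y xP
      by (auto simp: maximizers_def intro: order.trans[OF Max_ge])
  qed
qed

lemma card_maximizers_restrict:
  assumes "\<And>x. x < P \<Longrightarrow> x \<notin> pos ` {..<Q} \<Longrightarrow> \<exists>y<P. F x < F y"
    and "pos ` {..<Q} \<subseteq> {..<P}" and "inj_on pos {..<Q}"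
  shows "card (maximizers P F) = card (maximizers Q (F \<circ> pos))"
  unfolding maximizers_restrict[OF assms(1,2), simplified]
  by (intro card_image inj_on_subset[OF assms(3)]) (auto simp: maximizers_def)

section \<open>Values along a column\<close>

text \<open>
  The column over \<open>z\<close> meets \<open>[0, e Q + k')\<close> in its lowest \<open>e + [z < k']\<close> points. With \<open>P\<close> in
  place of the bound this also gives the lengths of the columns.
\<close>
lemma column_below_iff:
  fixes z Q k' e j :: nat
  assumes "z < Q" "k' < Q"
  shows "z + j * Q < e * Q + k' \<longleftrightarrow> j < e + of_bool (z < k')"
proof -
  consider "j < e" | "j = e" | "e < j" by linarith
  then show ?thesis
  proof cases
    case 1
    then have "Suc j * Q \<le> e * Q" by (intro mult_le_mono1) simp
    then show ?thesis using 1 assms by simp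
  next
    case 3
    then have "Suc e * Q \<le> j * Q" by (intro mult_le_mono1) simp
    then show ?thesis using 3 assms by simp
  qed auto
qed

text \<open>
  Climbing \<open>j\<close> steps pays \<open>h\<close> once for each starting point below \<open>k\<close>.
\<close>
lemma up_walk_column:
  assumes F: "up_walk h P Q A B (e * Q + k') F" and z: "z < Q" and k': "k' < Q"
    and "z + j * Q < P"
  shows "F (z + j * Q) = F z + int j * A - h * int (min j (e + of_bool (z < k')))"
  using assms(4)
proof (induction j)
  case (Suc j)
  let ?c = "e + of_bool (z < k')"
  have "F (z + j * Q + Q) = F (z + j * Q) + A - h * of_bool (j < ?c)"
    using F Suc.prems column_below_iff[OF z k', of j e] unfolding up_walk_def by auto
  moreover have "F (z + j * Q) = F z + int j * A - h * int (min j ?c)"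
    by (rule Suc.IH) (use Suc.prems in simp)
  moreover have "int (min (Suc j) ?c) = int (min j ?c) + of_bool (j < ?c)"
    by (cases "j < ?c") (simp_all add: min_def)
  ultimately show ?case by (simp add: algebra_simps)
qed simp

text \<open>
  Here the steps are taken downwards, so \<open>h\<close> is paid at the points of height \<open>1, \<dots>, j\<close>. This is why
  the number of points below \<open>k\<close> enters diminished by 1; it may be 0, and the truncated difference
  is then the correct value.
\<close>
lemma down_walk_column:
  assumes F: "down_walk h P Q A B (e * Q + k') F" and z: "z < Q" and k': "k' < Q"
    and "z + j * Q < P"
  shows "F (z + j * Q) = F z - int j * A + h * int (min j (e + of_bool (z < k') - 1))"
  using assms(4)
proof (induction j)
  case (Suc j)
  let ?c = "e + of_bool (z < k')"
  have "F (z + j * Q) = F (z + j * Q + Q) + A - h * of_bool (Suc j < ?c)"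
  proof -
    have "z + j * Q < P - Q" using Suc.prems by simp
    then have "F (z + j * Q) = F (z + j * Q + Q) + A - h * of_bool (z + j * Q + Q < e * Q + k')"
      using F unfolding down_walk_def by blast
    moreover have eq: "z + j * Q + Q = z + Suc j * Q" by simp
    ultimately show ?thesis unfolding eq column_below_iff[OF z k'] by simp
  qed
  moreover have "F (z + j * Q) = F z - int j * A + h * int (min j (?c - 1))"
    by (rule Suc.IH) (use Suc.prems in simp)
  moreover have "int (min (Suc j) (?c - 1)) = int (min j (?c - 1)) + of_bool (Suc j < ?c)"
    by (cases "Suc j < ?c") (simp_all add: min_def)
  ultimately show ?case by (simp add: algebra_simps)
qed simp

section \<open>One Euclidean step for a walk\<close>

text \<open>
  The first return to \<open>[0, Q)\<close>: climb a whole column and wrap around. Columns have \<open>m + 1\<close> points,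
  and one more over \<open>z < r\<close>, where \<open>P = (m + 1) Q + r\<close>. The extra point contributes the new wrapping
  increment \<open>A\<close>, and each column pays \<open>h\<close> exactly \<open>e + [z < k']\<close> times.
\<close>
lemma up_walk_induced:
  assumes F: "up_walk h P Q A B (e * Q + k') F"
    and P: "P = Suc m * Q + r" and r: "r < Q" and k': "k' < Q" and k: "e * Q + k' \<le> P"
  shows "down_walk h Q r (A * int (Suc m) + B - h * int e) A k' F"
proof -
  have PQ: "P - Q = m * Q + r" using P by simp
  have "F x = F (x + r) + (A * int (Suc m) + B - h * int e) - h * of_bool (x + r < k')"
    if x: "x < Q - r" for x
  proof -
    let ?c = "e + of_bool (x + r < k')"
    have z: "x + r < Q" using x by simp
    have c: "?c \<le> Suc m"
      using column_below_iff[OF z k', of "Suc m" e] k P by auto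
    have "F (x + r + m * Q) = F (x + r) + int m * A - h * int (min m ?c)"
      by (rule up_walk_column[OF F z k']) (use P r x in simp)
    moreover have "F x = F (x + r + m * Q) + A + B - h * of_bool (m < ?c)"
      using F x PQ column_below_iff[OF z k', of m e] unfolding up_walk_def
      by (simp add: add_ac)
    moreover have "int (min m ?c) = int e + of_bool (x + r < k') - of_bool (m < ?c)"
      using c by (cases "m < ?c"; cases "x + r < k'") (auto simp: min_def)
    ultimately have "F x = F (x + r) + int m * A
        - h * (int e + of_bool (x + r < k') - of_bool (m < ?c)) + A + B - h * of_bool (m < ?c)"
      by (simp only:)
    then show ?thesis by (simp add: algebra_simps)
  qed
  moreover have "F (x + (Q - r)) = F x + (A * int (Suc m) + B - h * int e) + A - h * of_bool (x < k')"
    if x: "x < r" for x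
  proof -
    let ?c = "e + of_bool (x < k')"
    have z: "x < Q" using x r by simp
    have c: "?c \<le> Suc (Suc m)"
      using column_below_iff[OF z k', of "Suc (Suc m)" e] k P r by auto
    have "F (x + Suc m * Q) = F x + int (Suc m) * A - h * int (min (Suc m) ?c)"
      by (rule up_walk_column[OF F z k']) (use P r x in simp)
    moreover have "F (x + (Q - r)) = F (x + Suc m * Q) + A + B - h * of_bool (Suc m < ?c)"
    proof -
      have eq: "x + (Q - r) + (P - Q) = x + Suc m * Q" "x + (Q - r) < Q"
        using PQ r x by simp_all
      have "F (x + (Q - r)) = F (x + (Q - r) + (P - Q)) + A + B
              - h * of_bool (x + (Q - r) + (P - Q) < e * Q + k')"
        using F eq(2) unfolding up_walk_def by blast
      then show ?thesis unfolding eq(1) column_below_iff[OF z k'] .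
    qed
    moreover have "int (min (Suc m) ?c) = int e + of_bool (x < k') - of_bool (Suc m < ?c)"
      using c by (cases "Suc m < ?c"; cases "x < k'") (auto simp: min_def)
    ultimately show ?thesis by (simp add: algebra_simps)
  qed
  ultimately show ?thesis unfolding down_walk_def by blast
qed

text \<open>
  Above \<open>[0, Q)\<close>, a point \<open>x < Q + k\<close> is reached from \<open>x - Q\<close> by a step that decreases, since
  \<open>A < h\<close>; any other point is at least \<open>k\<close> and is left by a step that increases, since \<open>A > 0\<close> and
  \<open>B \<ge> 0\<close>.
\<close>
lemma up_walk_maximizers:
  assumes F: "up_walk h P Q A B k F" and "0 < A" "A < h" "0 \<le> B" "Q < P"
  shows "maximizers P F = maximizers Q F"
proof -
  have "\<exists>y<P. F x < F y" if x: "x < P" "x \<notin> (\<lambda>x. x) ` {..<Q}" for x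
  proof (cases "x < Q + k")
    case True
    have "x - Q < P - Q" using x by auto
    then have "F (x - Q + Q) = F (x - Q) + A - h * of_bool (x - Q < k)"
      using F unfolding up_walk_def by blast
    then have "F x < F (x - Q)" using x True assms by (simp add: less_diff_conv2)
    then show ?thesis using x by (intro exI[of _ "x - Q"]) simp
  next
    case False
    show ?thesis
    proof (cases "x < P - Q")
      case True
      then have "F (x + Q) = F x + A" using F False unfolding up_walk_def by simp
      then show ?thesis using True assms by (intro exI[of _ "x + Q"]) simp
    next
      case f: False
      have "x - (P - Q) < Q" using x f by auto
      then have "F (x - (P - Q)) = F (x - (P - Q) + (P - Q)) + A + B
              - h * of_bool (x - (P - Q) + (P - Q) < k)"
        using F unfolding up_walk_def by blast
      then have "F x < F (x - (P - Q))" using assms False f by simp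
      then show ?thesis using x by (intro exI[of _ "x - (P - Q)"]) simp
    qed
  qed
  then show ?thesis
    using maximizers_restrict[of P "\<lambda>x. x" Q F] assms by (auto simp: comp_def)
qed

text \<open>
  The wrapping step, with its end point expressed through column and height: it ends at the top of
  the column over \<open>x + r\<close> modulo \<open>Q\<close>.
\<close>
lemma down_walk_last_step:
  assumes F: "down_walk h P Q A B (e * Q + k') F"
    and P: "P = Suc m * Q + r" and r: "r < Q" and x: "x < Q"
  shows "x < Q - r \<Longrightarrow> F (x + r + m * Q) = F x + A + B - h * of_bool (x < e * Q + k')"
    and "Q - r \<le> x \<Longrightarrow> F (x - (Q - r) + Suc m * Q) = F x + A + B - h * of_bool (x < e * Q + k')"
proof -
  have PQ: "P - Q = m * Q + r" using P by simp
  have *: "F (x + (m * Q + r)) = F x + A + B - h * of_bool (x < e * Q + k')"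
    using F x unfolding down_walk_def PQ by blast
  show "F (x + r + m * Q) = F x + A + B - h * of_bool (x < e * Q + k')"
    using * by (simp add: add_ac)
  assume "Q - r \<le> x"
  then have "x - (Q - r) + Suc m * Q = x + (m * Q + r)" using r by simp
  then show "F (x - (Q - r) + Suc m * Q) = F x + A + B - h * of_bool (x < e * Q + k')"
    using * by (simp only:)
qed

text \<open>
  For \<open>k < Q\<close> only the bottom points pay \<open>h\<close>, so that the return to \<open>[0, Q)\<close> consists of one
  wrapping step and a descent along a column of constant increment \<open>A\<close>.
\<close>
lemma down_walk_induced_bottom:
  assumes F: "down_walk h P Q A B k F"
    and P: "P = Suc m * Q + r" and r: "r < Q" and k: "k < Q"
  shows "up_walk h Q r (A * int (Suc m) + B) A k F"
proof -
  have F0: "down_walk h P Q A B (0 * Q + k) F" using F by simp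
  note col = down_walk_column[OF F0 _ k]
  note last = down_walk_last_step[OF F0 P r]
  have "F (x + r) = F x + (A * int (Suc m) + B) - h * of_bool (x < k)" if x: "x < Q - r" for x
  proof -
    have "F (x + r + m * Q) = F (x + r) - int m * A"
      using col[of "x + r" m] x P by simp
    moreover have "F (x + r + m * Q) = F x + A + B - h * of_bool (x < k)"
      using last(1)[of x] x by simp
    ultimately show ?thesis by (simp add: algebra_simps)
  qed
  moreover have "F x = F (x + (Q - r)) + (A * int (Suc m) + B) + A - h * of_bool (x + (Q - r) < k)"
    if x: "x < r" for x
  proof -
    have "F (x + Suc m * Q) = F x - int (Suc m) * A"
      using col[of x "Suc m"] x P r by simp
    moreover have "F (x + Suc m * Q) = F (x + (Q - r)) + A + B - h * of_bool (x + (Q - r) < k)"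
      using last(2)[of "x + (Q - r)"] x r by simp
    ultimately show ?thesis by (simp add: algebra_simps)
  qed
  ultimately show ?thesis unfolding up_walk_def by blast
qed

text \<open>
  For \<open>k < Q\<close> no step inside a column pays \<open>h\<close>, so the potential rises at every step down.
\<close>
lemma down_walk_maximizers_bottom:
  assumes F: "down_walk h P Q A B k F" and k: "k < Q" and "0 < A" "Q < P"
  shows "maximizers P F = maximizers Q F"
proof -
  have "\<exists>y<P. F x < F y" if x: "x < P" "x \<notin> (\<lambda>x. x) ` {..<Q}" for x
  proof -
    have "x - Q < P - Q" using x by auto
    then have "F (x - Q) = F (x - Q + Q) + A - h * of_bool (x - Q + Q < k)"
      using F unfolding down_walk_def by blast
    then have "F x < F (x - Q)" using x k assms by simp
    then show ?thesis using x by (intro exI[of _ "x - Q"]) simp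
  qed
  then show ?thesis
    using maximizers_restrict[of P "\<lambda>x. x" Q F] assms by (auto simp: comp_def)
qed

text \<open>
  The first return to \<open>[k - Q, k)\<close> for \<open>k = e Q + k'\<close>; this interval contains from each column the
  highest point below \<open>k\<close>.
  In the coordinate \<open>k - 1 - w\<close> the columns with \<open>e + 1\<close> points below \<open>k\<close> are exactly those with
  \<open>w < k'\<close>, so the return map is again a \<open>down_walk\<close>.
\<close>
lemma down_walk_induced_middle:
  assumes F: "down_walk h P Q A B (e * Q + k') F"
    and P: "P = Suc m * Q + r" and r: "r < Q" and k': "k' < Q" and e: "0 < e"
    and k: "e * Q + k' \<le> P"
  shows "down_walk h Q r (A * int (Suc m) + B - h * int e) A k' (\<lambda>w. F (e * Q + k' - 1 - w))"
proof -
  let ?c = "\<lambda>z. e + of_bool (z < k')"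
  \<comment> \<open>\<open>V z\<close> is the value at the highest point below \<open>k\<close> of the column over \<open>z\<close>; the coordinate \<open>w\<close>
    belongs to the column over \<open>z w\<close>.\<close>
  define V where "V z = F z + (int (?c z) - 1) * (h - A)" for z
  define z where "z w = (if w < k' then k' - 1 - w else Q + k' - 1 - w)" for w
  have V: "F (e * Q + k' - 1 - w) = V (z w)" if w: "w < Q" for w
  proof -
    have zQ: "z w < Q" using w k' by (auto simp: z_def)
    have pos: "e * Q + k' - 1 - w = z w + (?c (z w) - 1) * Q"
    proof (cases "w < k'")
      case True
      then show ?thesis by (simp add: z_def)
    next
      case False
      then have "\<not> z w < k'" using w by (simp add: z_def)
      moreover obtain e' where "e = Suc e'" using e gr0_implies_Suc by blast
      ultimately show ?thesis using False w by (simp add: z_def)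
    qed
    have below_P: "e * Q + k' - 1 - w < P" using P r k by auto
    have "F (z w + (?c (z w) - 1) * Q)
        = F (z w) - int (?c (z w) - 1) * A + h * int (min (?c (z w) - 1) (?c (z w) - 1))"
      by (rule down_walk_column[OF F zQ k']) (use below_P in \<open>simp only: pos\<close>)
    moreover have "int (?c (z w) - 1) = int (?c (z w)) - 1" using e by (simp add: of_nat_diff)
    ultimately show ?thesis unfolding pos V_def min.idem by (simp only: algebra_simps)
  qed
  note last = down_walk_last_step[OF F P r]
  have below: "x < e * Q + k'" if "x < Q" for x
    using that e by (cases e) auto
  have V1: "V (x + r) = V x + B + A * (int m + 1 + int (?c x) - int (?c (x + r))) - h * int (?c x)"
    if x: "x < Q - r" for x
  proof -
    have xr: "x + r < Q" using x by simp
    have "?c (x + r) \<le> Suc m"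
      using column_below_iff[OF xr k', of "Suc m" e] k P by auto
    then have mn: "int (min m (?c (x + r) - 1)) = int (?c (x + r)) - 1" using e by auto
    have "F (x + r + m * Q) = F (x + r) - int m * A + h * (int (?c (x + r)) - 1)"
      unfolding mn[symmetric] by (rule down_walk_column[OF F xr k']) (use P r x in simp)
    moreover have "F (x + r + m * Q) = F x + A + B - h"
      using last(1)[of x] x below[of x] by simp
    ultimately show ?thesis by (simp add: V_def algebra_simps)
  qed
  have V2: "V (x - (Q - r))
      = V x + B + A * (int m + 2 + int (?c x) - int (?c (x - (Q - r)))) - h * int (?c x)"
    if x: "x < Q" "Q - r \<le> x" for x
  proof -
    let ?y = "x - (Q - r)"
    have yr: "?y < Q" "?y < r" using x r by auto
    have "?c ?y \<le> Suc (Suc m)"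
      using column_below_iff[OF yr(1) k', of "Suc (Suc m)" e] k P r by auto
    then have mn: "int (min (Suc m) (?c ?y - 1)) = int (?c ?y) - 1" using e by auto
    have "F (?y + Suc m * Q) = F ?y - int (Suc m) * A + h * (int (?c ?y) - 1)"
      unfolding mn[symmetric] by (rule down_walk_column[OF F yr(1) k']) (use P yr(2) in simp)
    moreover have "F (?y + Suc m * Q) = F x + A + B - h"
      using last(2)[of x] x below[of x] by simp
    ultimately show ?thesis by (simp add: V_def algebra_simps)
  qed
  have "F (e * Q + k' - 1 - w) = F (e * Q + k' - 1 - (w + r))
      + (A * int (Suc m) + B - h * int e) - h * of_bool (w + r < k')" if w: "w < Q - r" for w
  proof -
    have wQ: "w < Q" "w + r < Q" using w by auto
    show ?thesis
    proof (cases "w < k' \<and> k' \<le> w + r")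
      case True
      then have z: "z w = z (w + r) - (Q - r)" "z (w + r) < Q" "Q - r \<le> z (w + r)"
         "z w < k'" "\<not> z (w + r) < k'"
        using wQ k' r by (auto simp: z_def)
      show ?thesis using V2[OF z(2,3)] z(4,5) True
        unfolding V[OF wQ(1)] V[OF wQ(2)] z(1)[symmetric] by (simp add: algebra_simps)
    next
      case False
      then have z: "z w = z (w + r) + r" "z (w + r) < Q - r"
          "z w < k' \<longleftrightarrow> w + r < k'" "z (w + r) < k' \<longleftrightarrow> w + r < k'"
        using wQ k' r by (auto simp: z_def)
      show ?thesis using V1[OF z(2)] z(3,4)
        unfolding V[OF wQ(1)] V[OF wQ(2)] z(1)[symmetric] by (simp add: algebra_simps)
    qed
  qed
  moreover have "F (e * Q + k' - 1 - (w + (Q - r))) = F (e * Q + k' - 1 - w)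
      + (A * int (Suc m) + B - h * int e) + A - h * of_bool (w < k')" if w: "w < r" for w
  proof -
    have wQ: "w < Q" "w + (Q - r) < Q" using w r by auto
    show ?thesis
    proof (cases "w < k' \<and> k' \<le> w + (Q - r)")
      case True
      then have z: "z (w + (Q - r)) = z w + r" "z w < Q - r"
         "z w < k'" "\<not> z (w + (Q - r)) < k'"
        using wQ k' r w by (auto simp: z_def)
      show ?thesis using V1[OF z(2)] z(3,4) True
        unfolding V[OF wQ(1)] V[OF wQ(2)] z(1)[symmetric] by (simp add: algebra_simps)
    next
      case False
      then have z: "z (w + (Q - r)) = z w - (Q - r)" "z w < Q" "Q - r \<le> z w"
          "z w < k' \<longleftrightarrow> w < k'" "z (w + (Q - r)) < k' \<longleftrightarrow> w < k'"
        using wQ k' r w by (auto simp: z_def)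
      show ?thesis using V2[OF z(2,3)] z(4,5)
        unfolding V[OF wQ(1)] V[OF wQ(2)] z(1)[symmetric] by (simp add: algebra_simps)
    qed
  qed
  ultimately show ?thesis unfolding down_walk_def by blast
qed

text \<open>
  If \<open>0 < A < h\<close>, going down a column the potential rises from points at or above \<open>k\<close> and falls
  from points below \<open>k\<close>. Hence each column peaks at its highest point below \<open>k\<close>.
\<close>
lemma down_walk_maximizers_middle:
  assumes F: "down_walk h P Q A B k F" and k: "Q \<le> k" "k \<le> P" and A: "0 < A" "A < h" and "0 < Q"
  shows "card (maximizers P F) = card (maximizers Q (\<lambda>w. F (k - 1 - w)))"
proof -
  let ?pos = "\<lambda>w. k - 1 - w"
  have "\<exists>y<P. F x < F y" if x: "x < P" "x \<notin> ?pos ` {..<Q}" for x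
  proof (cases "x < k")
    case True
    have xQ: "x + Q < k"
    proof (rule ccontr)
      assume "\<not> x + Q < k"
      then have "x = ?pos (k - 1 - x)" "k - 1 - x < Q" using True by auto
      then show False using x by blast
    qed
    then have "x < P - Q" using k by simp
    then have "F x = F (x + Q) + A - h * of_bool (x + Q < k)"
      using F unfolding down_walk_def by blast
    then have "F x < F (x + Q)" using A xQ by simp
    then show ?thesis using xQ k by (intro exI[of _ "x + Q"]) simp
  next
    case False
    then have "x - Q < P - Q" using x k by auto
    then have "F (x - Q) = F (x - Q + Q) + A - h * of_bool (x - Q + Q < k)"
      using F unfolding down_walk_def by blast
    then have "F x < F (x - Q)" using A False k by simp
    then show ?thesis using x by (intro exI[of _ "x - Q"]) simp
  qed
  moreover have "?pos ` {..<Q} \<subseteq> {..<P}" using k \<open>0 < Q\<close> by auto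
  moreover have "inj_on ?pos {..<Q}" using k by (auto simp: inj_on_def)
  ultimately show ?thesis using card_maximizers_restrict[of P ?pos Q F] by (simp add: comp_def)
qed

text \<open>
  The first return to \<open>[P - Q, P)\<close>, read backwards. Its increments pay \<open>h\<close> according to the position
  of the end point; traversing the orbit in the opposite direction turns end points into starting
  points and negates the increments, and the reflection \<open>P - 1 - w\<close> moves the paying interval
  \<open>[0, k)\<close> to the right end. Its complement \<open>[0, Q - k)\<close> then takes over the role of the paying
  interval at the cost of adding \<open>h\<close> to the constant increment.
\<close>
lemma down_walk_induced_top:
  assumes F: "down_walk h P Q A B k F"
    and P: "P = Suc m * Q + r" and r: "r < Q" and k: "k < Q"
  shows "up_walk h Q r (h - (A * int (Suc m) + B)) (- A) (Q - k) (\<lambda>w. F (P - 1 - w))"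
proof -
  have F0: "down_walk h P Q A B (0 * Q + k) F" using F by simp
  note col = down_walk_column[OF F0 _ k]
  have PQ: "P - Q = m * Q + r" using P by simp
  have last: "F (y + (P - Q)) = F y + A + B - h * of_bool (y < k)" if "y < Q" for y
    using F that unfolding down_walk_def by blast
  have "F (P - 1 - (w + r)) = F (P - 1 - w) + (h - (A * int (Suc m) + B)) - h * of_bool (w < Q - k)"
    if w: "w < Q - r" for w
  proof -
    let ?y = "Q - 1 - w"
    have y: "?y < Q" "P - 1 - w = ?y + (P - Q)" "P - 1 - (w + r) = ?y + m * Q"
      "w < Q - k \<longleftrightarrow> \<not> ?y < k" using w P k by auto
    have "F (?y + m * Q) = F ?y - int m * A" using col[of ?y m] y(1) w P by simp
    then show ?thesis using last[OF y(1)] unfolding y(2,3,4)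
      by (cases "?y < k") (simp_all add: algebra_simps)
  qed
  moreover have "F (P - 1 - w) = F (P - 1 - (w + (Q - r))) + (h - (A * int (Suc m) + B)) + - A
      - h * of_bool (w + (Q - r) < Q - k)" if w: "w < r" for w
  proof -
    let ?y = "r - 1 - w"
    have y: "?y < Q" "P - 1 - (w + (Q - r)) = ?y + (P - Q)" "P - 1 - w = ?y + Suc m * Q"
      "w + (Q - r) < Q - k \<longleftrightarrow> \<not> ?y < k" using w P k r by auto
    have "F (?y + Suc m * Q) = F ?y - int (Suc m) * A" using col[of ?y "Suc m"] y(1) w P by simp
    then show ?thesis using last[OF y(1)] unfolding y(2,3,4)
      by (cases "?y < k") (simp_all add: algebra_simps)
  qed
  ultimately show ?thesis unfolding up_walk_def by blast
qed

text \<open>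
  Both \<open>A\<close> and \<open>A - h\<close> are negative, so every step down a column falls.
\<close>
lemma down_walk_maximizers_top:
  assumes F: "down_walk h P Q A B k F" and A: "A < 0" "0 < h" and "Q < P"
  shows "card (maximizers P F) = card (maximizers Q (\<lambda>w. F (P - 1 - w)))"
proof -
  let ?pos = "\<lambda>w. P - 1 - w"
  have "\<exists>y<P. F x < F y" if x: "x < P" "x \<notin> ?pos ` {..<Q}" for x
  proof -
    have xQ: "x < P - Q"
    proof (rule ccontr)
      assume "\<not> x < P - Q"
      then have "x = ?pos (P - 1 - x)" "P - 1 - x < Q" using x(1) by auto
      then show False using x by blast
    qed
    then have "F x = F (x + Q) + A - h * of_bool (x + Q < k)"
      using F unfolding down_walk_def by blast
    then have "F x < F (x + Q)" using A by (auto simp: of_bool_def)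
    then show ?thesis using xQ by (intro exI[of _ "x + Q"]) simp
  qed
  moreover have "?pos ` {..<Q} \<subseteq> {..<P}" using \<open>Q < P\<close> by auto
  moreover have "inj_on ?pos {..<Q}" using \<open>Q < P\<close> by (auto simp: inj_on_def)
  ultimately show ?thesis using card_maximizers_restrict[of P ?pos Q F] by (simp add: comp_def)
qed

text \<open>
  With \<open>A = 0\<close> and \<open>k < Q\<close> the potential is constant on columns. Those over \<open>[0, r)\<close> have \<open>m + 2\<close>
  points, where \<open>P = (m + 1) Q + r\<close>.
\<close>
lemma down_walk_maximizers_tie:
  assumes F: "down_walk h P Q 0 B k F"
    and P: "P = Suc m * Q + r" and r: "r < Q" and k: "k < Q"
    and M: "maximizers Q F \<subseteq> {..<r}"
  shows "card (maximizers P F) = (m + 2) * card (maximizers Q F)"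
proof -
  let ?f = "\<lambda>(z, j). z + j * Q"
  have F0: "down_walk h P Q 0 B (0 * Q + k) F" using F by simp
  have Fmod: "F x = F (x mod Q)" if "x < P" for x
    using down_walk_column[OF F0 _ k, of "x mod Q" "x div Q"] r that by simp
  have "maximizers P F = ?f ` (maximizers Q F \<times> {..Suc m})"
  proof (intro equalityI subsetI)
    fix x assume x: "x \<in> maximizers P F"
    then have "x < P" by (simp add: maximizers_def)
    have "x mod Q \<in> maximizers Q F"
      using x Fmod[of x] P r by (auto simp: maximizers_def)
    moreover have "x div Q \<le> Suc m"
    proof -
      have "x < Suc (Suc m) * Q" using \<open>x < P\<close> P r by simp
      then show ?thesis by (simp add: less_mult_imp_div_less flip: less_Suc_eq_le)
    qed
    ultimately show "x \<in> ?f ` (maximizers Q F \<times> {..Suc m})"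
      by (intro image_eqI[of _ _ "(x mod Q, x div Q)"]) auto
  next
    fix x assume "x \<in> ?f ` (maximizers Q F \<times> {..Suc m})"
    then obtain z j where x: "x = z + j * Q" and z: "z \<in> maximizers Q F" and j: "j \<le> Suc m"
      by auto
    have zr: "z < r" using z M by auto
    have "j * Q \<le> Suc m * Q" using j by (rule mult_le_mono1)
    then have "x < P" using x zr P by simp
    moreover have "x mod Q = z" using x zr r by simp
    ultimately show "x \<in> maximizers P F"
      using z Fmod r by (auto simp: maximizers_def)
  qed
  moreover have "inj_on ?f (maximizers Q F \<times> {..Suc m})"
  proof (rule inj_on_inverseI)
    fix u assume "u \<in> maximizers Q F \<times> {..Suc m}"
    then obtain z j where "u = (z, j)" "z < Q" by (auto simp: maximizers_def)
    then show "(\<lambda>x. (x mod Q, x div Q)) (?f u) = u" by simp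
  qed
  ultimately show ?thesis by (simp add: card_image card_cartesian_product)
qed

section \<open>The product over the Euclidean algorithm\<close>

text \<open>
  The product runs over all \<open>j\<close>, including \<open>j = 0\<close>, so that it splits off one factor for each step of
  the Euclidean algorithm.
\<close>
definition tie_weight :: "nat \<Rightarrow> nat \<Rightarrow> nat \<Rightarrow> nat" where
  "tie_weight h P Q =
     (\<Prod>j | j < euclid_len P Q \<and> h dvd euclid_rem P Q j. euclid_coeff P Q (j + 1) + 1)"

lemma euclid_rem_Suc: "euclid_rem P Q (Suc j) = euclid_rem Q (P mod Q) j"
  by (induction j rule: induct_nat_012) simp_all

lemma euclid_coeff_Suc: "euclid_coeff P Q (Suc (Suc j)) = euclid_coeff Q (P mod Q) (Suc j)"
  by (cases j) (simp_all add: euclid_rem_Suc)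

lemma euclid_rem_reaches_0: "\<exists>n. euclid_rem P Q n = 0"
proof (induction Q arbitrary: P rule: less_induct)
  case (less Q)
  show ?case
  proof (cases "Q = 0")
    case True
    then show ?thesis by (intro exI[of _ 0]) simp
  next
    case False
    then obtain n where "euclid_rem Q (P mod Q) n = 0" using less[of "P mod Q" Q] by auto
    then show ?thesis by (intro exI[of _ "Suc n"]) (simp only: euclid_rem_Suc)
  qed
qed

lemma euclid_len_0: "euclid_len P 0 = 0"
  by (simp add: euclid_len_def Least_eq_0)

lemma euclid_len_Suc:
  assumes "0 < Q"
  shows "euclid_len P Q = Suc (euclid_len Q (P mod Q))"
proof -
  obtain n where "euclid_rem P Q n = 0" using euclid_rem_reaches_0 by blast
  then show ?thesis using assms
    unfolding euclid_len_def by (subst Least_Suc) (auto simp: euclid_rem_Suc)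
qed

lemma tie_weight_0: "tie_weight h P 0 = 1"
  by (simp add: tie_weight_def euclid_len_0)

lemma tie_weight_rec:
  assumes "0 < Q"
  shows "tie_weight h P Q = (if h dvd Q then P div Q + 1 else 1) * tie_weight h Q (P mod Q)"
proof -
  let ?I = "{j. j < euclid_len Q (P mod Q) \<and> h dvd euclid_rem Q (P mod Q) j}"
  have index: "{j. j < euclid_len P Q \<and> h dvd euclid_rem P Q j} = (if h dvd Q then {0} else {}) \<union> Suc ` ?I"
  proof (intro set_eqI)
    fix j
    show "j \<in> {j. j < euclid_len P Q \<and> h dvd euclid_rem P Q j} \<longleftrightarrow>
        j \<in> (if h dvd Q then {0} else {}) \<union> Suc ` ?I"
      using assms by (cases j) (auto simp: euclid_len_Suc euclid_rem_Suc)
  qed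
  have "(\<Prod>j\<in>Suc ` ?I. euclid_coeff P Q (j + 1) + 1) = tie_weight h Q (P mod Q)"
    by (simp add: tie_weight_def prod.reindex euclid_coeff_Suc del: euclid_coeff.simps)
  moreover have "finite ?I" by simp
  ultimately show ?thesis
    by (cases "h dvd Q") (simp_all add: tie_weight_def[of h P Q] index)
qed

section \<open>Counting the maximizers of a walk\<close>

text \<open>
  Induction along the Euclidean algorithm. The hypotheses on \<open>A\<close>, \<open>B\<close> and \<open>h\<close> are those that reproduce
  themselves: the relation \<open>A P + B Q = h k\<close> bounds the new \<open>A\<close>, the wrapping increment \<open>B\<close> is up to
  sign the previous \<open>A\<close>, and the absence of a common factor makes \<open>A = 0\<close> equivalent to \<open>h dvd Q\<close>.
  Only a \<open>down_walk\<close> can have \<open>A \<le> 0\<close>; its four cases are \<open>0 < A\<close> with \<open>k < Q\<close> (restrict to the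
  bottom), \<open>0 < A\<close> with \<open>Q \<le> k\<close> (middle), \<open>A < 0\<close> (top) and the tie \<open>A = 0\<close>.
\<close>
lemma card_maximizers_walk:
  fixes h P Q k :: nat
  assumes "coprime P Q" "Q < P"
    and "\<And>x. x dvd A \<Longrightarrow> x dvd B \<Longrightarrow> x dvd int h \<Longrightarrow> is_unit x"
    and "A * int P + B * int Q = int h * int k"
    and "up_walk h P Q A B k F \<and> 0 < A \<and> A < int h \<and> 0 \<le> B \<and> k \<le> P \<or>
         down_walk h P Q A B k F \<and> 0 < B \<and> B < int h \<and> k < P"
  shows "card (maximizers P F) = tie_weight h P Q"
  using assms
proof (induction P arbitrary: Q A B k F rule: less_induct)
  case (less P)
  note cop = less.prems(1) and QP = less.prems(2) and unit = less.prems(3)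
    and flux = less.prems(4) and walk = less.prems(5)
  have single: "card (maximizers 1 G) = 1" for G
  proof -
    have "maximizers 1 G = {0}" by (auto simp: maximizers_def)
    then show ?thesis by simp
  qed
  show ?case
  proof (cases "Q = 0")
    case True
    then show ?thesis using cop single[of F] by (simp add: tie_weight_0)
  next
    case False
    define r where "r = P mod Q"
    define m where "m = P div Q - 1"
    define e where "e = k div Q"
    define k' where "k' = k mod Q"
    have r: "r < Q" and k': "k' < Q" using False by (simp_all add: r_def k'_def)
    have "P div Q \<noteq> 0" using QP False by (simp add: div_eq_0_iff)
    then have m: "P div Q = Suc m" by (simp add: m_def)
    have P: "P = Suc m * Q + r"
      using div_mult_mod_eq[of P Q] unfolding m r_def by simp
    have k: "k = e * Q + k'" by (simp add: e_def k'_def)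
    have cop': "coprime Q r"
      using cop gcd_red_nat[of P Q] by (simp add: r_def coprime_iff_gcd_eq_1)
    have Pi: "int P = int Q + int m * int Q + int r" unfolding P by simp
    have ki: "int k = int e * int Q + int k'" unfolding k by simp
    have weight: "tie_weight h P Q = (if h dvd Q then m + 2 else 1) * tie_weight h Q r"
      using tie_weight_rec[of Q h P] False m by (simp add: r_def)
    \<comment> \<open>For \<open>r = 0\<close> coprimality forces \<open>Q = 1\<close>: the count is then trivially 1, and the bounds may fail.\<close>
    have next_level: "card (maximizers Q G) = tie_weight h Q r"
      if "\<And>x. x dvd A' \<Longrightarrow> x dvd B' \<Longrightarrow> x dvd int h \<Longrightarrow> is_unit x"
        and "A' * int Q + B' * int r = int h * int c"
        and "0 < r \<Longrightarrow>
          up_walk h Q r A' B' c G \<and> 0 < A' \<and> A' < int h \<and> 0 \<le> B' \<and> c \<le> Q \<or>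
          down_walk h Q r A' B' c G \<and> 0 < B' \<and> B' < int h \<and> c < Q"
      for A' B' c G
    proof (cases "r = 0")
      case True
      then show ?thesis using cop' single[of G] by (simp add: tie_weight_0)
    next
      case False
      then show ?thesis using less.IH[OF QP cop' r that(1,2)] that(3) by blast
    qed
    \<comment> \<open>From \<open>A P + B Q = h k\<close>, a divisor \<open>h\<close> of \<open>Q\<close> divides \<open>A P\<close>, hence \<open>A\<close>.\<close>
    have coph: "A = 0" if "h dvd Q" "\<bar>A\<bar> < int h"
    proof -
      have "coprime (int h) (int P)"
        using that(1) cop by (meson coprime_commute coprime_divisors coprime_int_iff dvd_refl)
      moreover have "int h dvd A * int P"
      proof -
        have "A * int P = int h * int k - B * int Q" using flux by simp
        then show ?thesis using that(1) by simp
      qed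
      ultimately have "int h dvd A" by (simp add: coprime_dvd_mult_left_iff)
      then show "A = 0" using that(2) zdvd_not_zless [of "\<bar>A\<bar>" "int h"] by auto
    qed
    have Q0: "0 < int Q" and P0: "0 < int P" using False QP by simp_all
    from walk show ?thesis
    proof (elim disjE conjE)
      assume F: "up_walk h P Q A B k F" and A: "0 < A" "A < int h" and B: "0 \<le> B" and kP: "k \<le> P"
      let ?A = "A * int (Suc m) + B - int h * int e"
      have "card (maximizers Q F) = tie_weight h Q r"
      proof (rule next_level[of ?A A k'])
        fix x assume x: "x dvd ?A" "x dvd A" "x dvd int h"
        have "x dvd ?A - A * int (Suc m) + int h * int e"
          by (rule dvd_add[OF dvd_diff[OF x(1) dvd_mult2[OF x(2)]] dvd_mult2[OF x(3)]])
        moreover have "?A - A * int (Suc m) + int h * int e = B" by simp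
        ultimately have "x dvd B" by (simp only:)
        then show "is_unit x" using x unit by blast
      next
        show "?A * int Q + A * int r = int h * int k'"
          using flux unfolding Pi ki by (simp add: algebra_simps)
      next
        have "down_walk h Q r ?A A k' F"
          using up_walk_induced[OF F[unfolded k] P r k'] kP k by simp
        then show "up_walk h Q r ?A A k' F \<and> 0 < ?A \<and> ?A < int h \<and> 0 \<le> A \<and> k' \<le> Q \<or>
            down_walk h Q r ?A A k' F \<and> 0 < A \<and> A < int h \<and> k' < Q"
          using A k' by blast
      qed
      moreover have "\<not> h dvd Q" using coph A by auto
      ultimately show ?thesis using weight up_walk_maximizers[OF F A B QP] by simp
    next
      assume F: "down_walk h P Q A B k F" and B: "0 < B" "B < int h" and kP: "k < P"
      have h0: "0 < int h" using B by simp
      have BQ: "B * int Q < int h * int Q" "0 < B * int Q" using B Q0 by simp_all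
      let ?A = "A * int (Suc m) + B"
      have flux': "?A * int Q + A * int r = int h * int k"
        using flux unfolding Pi by (simp add: algebra_simps)
      have unit': "is_unit x" if x: "x dvd ?A" "x dvd A" "x dvd int h" for x
      proof -
        have "x dvd ?A - A * int (Suc m)" by (rule dvd_diff[OF x(1) dvd_mult2[OF x(2)]])
        moreover have "?A - A * int (Suc m) = B" by simp
        ultimately have "x dvd B" by (simp only:)
        then show ?thesis using x unit by blast
      qed
      consider "0 < A" "k < Q" | "0 < A" "Q \<le> k" | "A < 0" | "A = 0" by linarith
      then show ?thesis
      proof cases
        case 1
        then have hk: "int h * int k < int h * int Q" using h0 by simp
        have Ah: "A < int h"
        proof -
          have "A * int P < int h * int Q" using flux hk BQ by linarith
          also have "\<dots> \<le> int h * int P" using QP h0 by simp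
          finally show ?thesis by (simp add: mult_less_cancel_right)
        qed
        have "card (maximizers Q F) = tie_weight h Q r"
        proof (rule next_level[of ?A A k, OF unit' flux'])
          have "?A * int Q < int h * int Q" using flux' hk 1(1)
            mult_nonneg_nonneg[of A "int r"] by linarith
          then have "?A < int h" using Q0 by (simp only: mult_less_cancel_right_pos)
          moreover have "0 < ?A" using 1(1) B by (simp add: add_pos_pos)
          ultimately show "up_walk h Q r ?A A k F \<and> 0 < ?A \<and> ?A < int h \<and> 0 \<le> A \<and> k \<le> Q \<or>
              down_walk h Q r ?A A k F \<and> 0 < A \<and> A < int h \<and> k < Q"
            using down_walk_induced_bottom[OF F P r 1(2)] 1 by simp
        qed
        moreover have "\<not> h dvd Q" using coph Ah 1 by auto
        ultimately show ?thesis
          using weight down_walk_maximizers_bottom[OF F 1(2,1) QP] by simp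
      next
        case 2
        have Ah: "A < int h"
        proof -
          have "A * int P < int h * int k" using flux BQ by linarith
          also have "\<dots> \<le> int h * int P" using kP h0 by simp
          finally show ?thesis by (simp add: mult_less_cancel_right)
        qed
        let ?G = "\<lambda>w. F (k - 1 - w)"
        have "card (maximizers Q ?G) = tie_weight h Q r"
        proof (rule next_level[of "?A - int h * int e" A k'])
          fix x assume x: "x dvd ?A - int h * int e" "x dvd A" "x dvd int h"
          have "x dvd ?A - int h * int e + int h * int e" by (rule dvd_add[OF x(1) dvd_mult2[OF x(3)]])
          then have "x dvd ?A" by (simp only: diff_add_cancel)
          then show "is_unit x" using x unit' by blast
        next
          show "(?A - int h * int e) * int Q + A * int r = int h * int k'"
            using flux' unfolding ki by (simp add: algebra_simps)
        next
          have "0 < e" using 2 Q0 by (simp add: e_def div_greater_zero_iff)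
          then have "down_walk h Q r (?A - int h * int e) A k' ?G"
            using down_walk_induced_middle[OF F[unfolded k] P r k'] kP k by simp
          then show "up_walk h Q r (?A - int h * int e) A k' ?G \<and> 0 < ?A - int h * int e \<and>
                ?A - int h * int e < int h \<and> 0 \<le> A \<and> k' \<le> Q \<or>
              down_walk h Q r (?A - int h * int e) A k' ?G \<and> 0 < A \<and> A < int h \<and> k' < Q"
            using 2 Ah k' by blast
        qed
        moreover have "\<not> h dvd Q" using coph Ah 2 by auto
        ultimately show ?thesis
          using weight down_walk_maximizers_middle[OF F 2(2) _ 2(1) Ah] kP Q0 by simp
      next
        case 3
        have AP: "A * int P < 0" using 3 QP by (simp add: mult_less_0_iff)
        have "int h * int k < int h * int Q" using flux BQ AP by linarith
        then have kQ: "k < Q" using h0 by (simp add: mult_less_cancel_left)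
        have ArP: "A * int P \<le> A * int r" using 3 r QP by (simp add: mult_left_mono_neg)
        have Ah: "- A < int h"
        proof -
          have "0 \<le> int h * int k" by simp
          then have "- A * int P < int h * int Q" using flux BQ(1) unfolding mult_minus_left by linarith
          also have "\<dots> \<le> int h * int P" using QP h0 by simp
          finally show ?thesis using P0 by (simp only: mult_less_cancel_right_pos)
        qed
        let ?G = "\<lambda>w. F (P - 1 - w)"
        have "card (maximizers Q ?G) = tie_weight h Q r"
        proof (rule next_level[of "int h - ?A" "- A" "Q - k"])
          fix x assume x: "x dvd int h - ?A" "x dvd - A" "x dvd int h"
          have "x dvd int h - (int h - ?A)" by (rule dvd_diff[OF x(3,1)])
          moreover have "int h - (int h - ?A) = ?A" by simp
          ultimately have "x dvd ?A" by (simp only:)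
          then show "is_unit x" using x unit' by simp
        next
          show "(int h - ?A) * int Q + - A * int r = int h * int (Q - k)"
            using flux' kQ by (simp add: algebra_simps of_nat_diff)
        next
          assume "0 < r"
          then have "A * int r < 0" using 3 by (simp add: mult_less_0_iff)
          moreover have "0 \<le> int h * int k" by simp
          ultimately have "0 < ?A * int Q" using flux' by linarith
          then have "0 < ?A" using Q0 by (simp only: zero_less_mult_pos2)
          moreover have A_lt: "?A * int Q < int h * int Q"
            using flux' flux ArP BQ by linarith
          then have "?A < int h" using Q0 by (simp only: mult_less_cancel_right_pos)
          ultimately show "up_walk h Q r (int h - ?A) (- A) (Q - k) ?G \<and> 0 < int h - ?A \<and>
                int h - ?A < int h \<and> 0 \<le> - A \<and> Q - k \<le> Q \<or>
              down_walk h Q r (int h - ?A) (- A) (Q - k) ?G \<and> 0 < - A \<and> - A < int h \<and> Q - k < Q"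
            using down_walk_induced_top[OF F P r kQ] 3 by simp
        qed
        moreover have "\<not> h dvd Q" using coph Ah 3 by auto
        ultimately show ?thesis
          using weight down_walk_maximizers_top[OF F 3 h0 QP] by simp
      next
        case 4
        have BQk: "B * int Q = int h * int k" using flux 4 by simp
        then have "int h * int k < int h * int Q" using BQ by simp
        then have kQ: "k < Q" using h0 by (simp add: mult_less_cancel_left)
        have "coprime (int h) B" using unit 4 by (intro coprimeI) auto
        moreover have "int h dvd B * int Q" unfolding BQk by simp
        ultimately have hQ: "h dvd Q" by (simp add: coprime_dvd_mult_right_iff)
        have up: "up_walk h Q r B 0 k F"
          using down_walk_induced_bottom[OF F P r kQ] 4 by simp
        have "card (maximizers Q F) = tie_weight h Q r"
          by (rule next_level[of B 0 k]) (use unit 4 BQk up B kQ in auto)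
        moreover have "maximizers Q F \<subseteq> {..<r}"
          using up_walk_maximizers[OF up B] r by (auto simp: maximizers_def)
        ultimately show ?thesis
          using down_walk_maximizers_tie[of h P Q B k F m r] F 4 P r kQ weight hQ by simp
      qed
    qed
  qed
qed

section \<open>The sequence as a walk of step q\<close>

lemma bij_betw_add_mod:
  fixes p a :: nat
  shows "bij_betw (\<lambda>x. (x + a) mod p) {..<p} {..<p}"
proof -
  have inj: "inj_on (\<lambda>x. (x + a) mod p) {..<p}"
  proof (rule inj_onI)
    fix x y assume "x \<in> {..<p}" "y \<in> {..<p}" "(x + a) mod p = (y + a) mod p"
    then have "[x + a = y + a] (mod p)" "x < p" "y < p" by (simp_all add: cong_def)
    then show "x = y" by (simp add: cong_add_rcancel_nat cong_less_modulus_unique_nat)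
  qed
  moreover have "(\<lambda>x. (x + a) mod p) ` {..<p} = {..<p}"
    by (rule endo_inj_surj[OF _ _ inj]) auto
  ultimately show ?thesis by (simp add: bij_betw_def)
qed

lemma mult_div_common_dvd:
  fixes a b d :: nat
  assumes "d dvd a" "d dvd b"
  shows "a * (b div d) = (a div d) * b"
  using assms by (cases "d = 0") (auto elim!: dvdE)

lemma is_seq_S_seq:
  assumes "0 < p"
  shows "is_seq p q k (S_seq p q k)"
  unfolding S_seq_def by (rule theI'[OF ex1_is_seq[OF assms]])

context
  fixes p q k :: nat
  assumes q: "0 < q" and qp: "q < p" and cop: "coprime p q" and k0: "0 < k" and kp: "k < p"
begin

lemma inv_mod_cong: "[inv_mod p q * q = 1] (mod p)"
proof -
  obtain x where x: "[q * x = 1] (mod p)"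
    using cong_solve_coprime_nat[of q p] cop by (auto simp: coprime_commute)
  have "0 < x" using x q qp by (cases "x = 0") (auto simp: cong_def)
  moreover have "[x * q = 1] (mod p)" using x by (simp only: mult.commute)
  ultimately show ?thesis
    unfolding inv_mod_def using LeastI[of "\<lambda>a. 0 < a \<and> [a * q = 1] (mod p)" x] by blast
qed

text \<open>
  This locates the end of the progression \<open>S\<close>, the point at which its translate by \<open>q\<close> leaves it.
\<close>
lemma seq_l_times_q: "(seq_l p q k * q) mod p = k"
proof -
  have "[seq_l p q k * q = inv_mod p q * k * q] (mod p)"
    unfolding seq_l_def by (intro cong_scalar_right) simp
  also have "inv_mod p q * k * q = inv_mod p q * q * k" by simp
  also have "[inv_mod p q * q * k = 1 * k] (mod p)"
    by (rule cong_scalar_right[OF inv_mod_cong])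
  finally show ?thesis using kp by (simp add: cong_def)
qed

lemma seq_l_less: "seq_l p q k < p"
  using kp by (simp add: seq_l_def)

lemma seq_l_pos: "0 < seq_l p q k"
proof (rule ccontr)
  assume "\<not> 0 < seq_l p q k"
  then have "seq_l p q k = 0" by simp
  then have "0 = k" using seq_l_times_q by (simp only: mult_0 mod_0)
  then show False using k0 by simp
qed

lemma gcd_seq_l: "gcd p (seq_l p q k) = gcd p k"
proof -
  have "gcd p (seq_l p q k) = gcd p (seq_l p q k * q)"
    using gcd_mult_right_right_cancel[OF cop] by simp
  also have "\<dots> = gcd p ((seq_l p q k * q) mod p)"
    unfolding gcd.commute[of p "seq_l p q k * q"] by (rule gcd_red_nat)
  finally show ?thesis by (simp only: seq_l_times_q)
qed

lemma seq_t_theta: "p * seq_t p q k = theta p k * seq_l p q k"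
proof -
  have "gcd p k dvd seq_l p q k" using gcd_dvd2[of p "seq_l p q k"] by (simp only: gcd_seq_l)
  then show ?thesis unfolding seq_t_def theta_def gcd_seq_l
    by (intro mult_div_common_dvd) simp_all
qed

lemma multiples_mod_inj:
  assumes "(i * q) mod p = (j * q) mod p" "i < p" "j < p"
  shows "i = j"
proof -
  have "[i * q = j * q] (mod p)" using assms(1) by (simp add: cong_def)
  then have "[i = j] (mod p)" using cop
    by (simp add: cong_mult_rcancel_nat coprime_commute)
  then show ?thesis using assms(2,3) by (simp add: cong_less_modulus_unique_nat)
qed

lemma card_seq_steps: "card (seq_steps p q k) = seq_l p q k"
proof -
  have "inj_on (\<lambda>i. (i * q) mod p) {1..seq_l p q k}"
    using seq_l_less by (intro inj_onI, elim multiples_mod_inj) auto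
  then show ?thesis by (simp add: seq_steps_def card_image)
qed

lemma seq_steps_subset: "seq_steps p q k \<subseteq> {0<..<p}"
proof
  fix x assume "x \<in> seq_steps p q k"
  then obtain i where i: "1 \<le> i" "i \<le> seq_l p q k" "x = (i * q) mod p"
    by (auto simp: seq_steps_def)
  have "x \<noteq> 0" using multiples_mod_inj[of i 0] i seq_l_less by auto
  then show "x \<in> {0<..<p}" using i(3) qp by simp
qed

text \<open>
  Translation by \<open>q\<close> moves the progression \<open>S\<close> one step along itself, so it preserves membership
  except at two points: \<open>k\<close>, the end of \<open>S\<close>, is moved out of \<open>S\<close>, and \<open>0\<close>, which is excluded here,
  is moved into \<open>S\<close>.
\<close>
lemma seq_steps_shift:
  assumes y: "0 < y" "y < p"
  shows "(y + q) mod p \<in> seq_steps p q k \<longleftrightarrow> y \<in> seq_steps p q k \<and> y \<noteq> k"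
proof
  assume "(y + q) mod p \<in> seq_steps p q k"
  then obtain i where i: "1 \<le> i" "i \<le> seq_l p q k" "(y + q) mod p = (i * q) mod p"
    by (auto simp: seq_steps_def)
  obtain j where j: "i = Suc j" using i(1) by (cases i) auto
  have "[y + q = j * q + q] (mod p)" using i(3) unfolding j by (simp add: cong_def add.commute)
  then have "[y = j * q] (mod p)" by (simp only: cong_add_rcancel_nat)
  then have yj: "y = (j * q) mod p" using y by (simp add: cong_def)
  have "j \<noteq> 0" using yj y by (cases j) auto
  moreover have "y \<noteq> k"
    using multiples_mod_inj[of j "seq_l p q k"] yj seq_l_times_q seq_l_less i(2) j by auto
  ultimately show "y \<in> seq_steps p q k \<and> y \<noteq> k"
    using yj i(2) j by (auto simp: seq_steps_def)
next
  assume "y \<in> seq_steps p q k \<and> y \<noteq> k"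
  then obtain i where i: "1 \<le> i" "i \<le> seq_l p q k" "y = (i * q) mod p" "y \<noteq> k"
    by (auto simp: seq_steps_def)
  then have "i \<noteq> seq_l p q k" using seq_l_times_q by auto
  moreover have "(y + q) mod p = (Suc i * q) mod p"
    unfolding i(3) by (simp add: mod_add_right_eq add.commute)
  ultimately show "(y + q) mod p \<in> seq_steps p q k"
    unfolding seq_steps_def using i(1,2) by (intro image_eqI[of _ _ "Suc i"]) simp_all
qed

lemma k_in_seq_steps: "k \<in> seq_steps p q k"
  unfolding seq_steps_def
  using seq_l_pos
  by (intro image_eqI[of _ _ "seq_l p q k"]) (simp_all add: seq_l_times_q)

text \<open>
  The step from \<open>p - 1\<close> back to \<open>0\<close> obeys the same rule because the increments of a full turn add
  up to \<open>p t - \<theta> l = 0\<close>.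
\<close>
lemma S_seq_cyclic_step:
  assumes "x < p"
  shows "S_seq p q k ((x + 1) mod p) - S_seq p q k x
    = int (seq_t p q k) - int (theta p k) * of_bool ((x + 1) mod p \<in> seq_steps p q k)"
proof -
  let ?g = "S_seq p q k" and ?S = "seq_steps p q k"
  let ?t = "int (seq_t p q k)" and ?h = "int (theta p k)"
  have p0: "0 < p" using kp by simp
  have step: "?g (Suc x) - ?g x = ?t - ?h * of_bool (Suc x \<in> ?S)" if "Suc x < p" for x
  proof -
    have "\<forall>x. 0 < x \<and> x < p \<longrightarrow> ?g x - ?g (x - 1) = (if x \<in> ?S then ?t - ?h else ?t)"
      using is_seq_S_seq[OF p0, of q k] unfolding is_seq_def by blast
    from this[rule_format, of "Suc x"] show ?thesis using that by simp
  qed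
  show ?thesis
  proof (cases "Suc x < p")
    case True
    then show ?thesis using step by simp
  next
    case False
    then have x: "Suc x = p" using assms by simp
    have "?g n - ?g 0 = ?t * int n - ?h * int (card (?S \<inter> {..n}))" if "n < p" for n
      using that
    proof (induction n)
      case 0
      have "?S \<inter> {..0} = {}" using seq_steps_subset by auto
      then show ?case by simp
    next
      case (Suc n)
      have "?S \<inter> {..Suc n} = (if Suc n \<in> ?S then {Suc n} else {}) \<union> (?S \<inter> {..n})"
        by (auto simp: le_Suc_eq)
      then have "card (?S \<inter> {..Suc n}) = of_bool (Suc n \<in> ?S) + card (?S \<inter> {..n})"
        by simp
      moreover have "?g n - ?g 0 = ?t * int n - ?h * int (card (?S \<inter> {..n}))"
        using Suc by simp
      ultimately show ?case using step[OF Suc.prems] by (simp add: algebra_simps)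
    qed
    note total = this[OF assms]
    have "?S \<inter> {..x} = ?S" using seq_steps_subset x by auto
    then have "?g x - ?g 0 = ?t * int x - ?h * int (seq_l p q k)"
      using total card_seq_steps by simp
    also have "?h * int (seq_l p q k) = int p * ?t"
      using seq_t_theta by (simp flip: of_nat_mult)
    also have "int p = int x + 1" using x by simp
    finally have "?g 0 - ?g x = ?t" by (simp add: algebra_simps)
    moreover have "0 \<notin> ?S" using seq_steps_subset by auto
    ultimately show ?thesis using x by simp
  qed
qed

text \<open>
  Let \<open>E(x)\<close> be the increment over a step of length \<open>q\<close>. By \<open>seq_steps_shift\<close>, \<open>E\<close> is constant apart
  from a jump by \<open>\<theta>\<close> at \<open>k\<close>. As \<open>E\<close> sums to zero over a full turn, its value is determined.
\<close>
lemma S_seq_q_step: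
  assumes "x < p"
  shows "S_seq p q k ((x + q) mod p) - S_seq p q k x
    = int (k div gcd p k) - int (theta p k) * of_bool (x < k)"
proof -
  let ?g = "S_seq p q k" and ?S = "seq_steps p q k"
  let ?t = "int (seq_t p q k)" and ?h = "int (theta p k)"
  define E where "E x = ?g ((x + q) mod p) - ?g x" for x
  have p0: "0 < p" using kp by simp
  have E_Suc: "E (Suc y) - E y = ?h * of_bool (Suc y = k)" if y: "Suc y < p" for y
  proof -
    have "(((y + q) mod p) + 1) mod p = (Suc y + q) mod p" by (simp add: mod_simps)
    then have "E (Suc y) - E y = ?h * of_bool (Suc y \<in> ?S) - ?h * of_bool ((Suc y + q) mod p \<in> ?S)"
      using S_seq_cyclic_step[of y] S_seq_cyclic_step[of "(y + q) mod p"] y p0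
      unfolding E_def by simp
    also have "\<dots> = ?h * of_bool (Suc y = k)"
      using seq_steps_shift[of "Suc y"] y k_in_seq_steps by auto
    finally show ?thesis .
  qed
  have E_eq: "E y = E 0 + ?h - ?h * of_bool (y < k)" if "y < p" for y
    using that
  proof (induction y)
    case 0
    then show ?case using k0 by simp
  next
    case (Suc y)
    then show ?case using E_Suc[of y] by (auto simp: of_bool_def split: if_splits)
  qed
  have "(\<Sum>y<p. E 0 + ?h - ?h * of_bool (y < k)) = (\<Sum>y<p. E y)"
    by (rule sum.cong[OF refl], rule E_eq[symmetric]) simp
  also have "\<dots> = (\<Sum>y<p. ?g ((y + q) mod p)) - (\<Sum>y<p. ?g y)"
    by (simp add: E_def sum_subtractf)
  also have "\<dots> = 0"
    using sum.reindex_bij_betw[OF bij_betw_add_mod[of q p], of ?g] by simp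
  finally have "0 = (\<Sum>y<p. E 0 + ?h - ?h * of_bool (y < k))" by (rule sym)
  also have "\<dots> = int p * (E 0 + ?h) - ?h * (\<Sum>y<p. of_bool (y < k))"
    unfolding sum_subtractf sum_distrib_left[symmetric] by simp
  also have "(\<Sum>y<p. of_bool (y < k)) = int k"
  proof -
    have "{..<p} \<inter> {y. y < k} = {..<k}" using kp by auto
    then show ?thesis by (simp add: sum_of_bool_eq)
  qed
  finally have "int p * (E 0 + ?h) = ?h * int k" by simp
  also have "\<dots> = int p * int (k div gcd p k)"
    unfolding theta_def of_nat_mult[symmetric] by (simp add: mult_div_common_dvd)
  finally have "E 0 + ?h = int (k div gcd p k)" using p0 by simp
  then show ?thesis using E_eq[OF assms] by (simp add: E_def)
qed

text \<open>
  Negation turns the increment \<open>s - \<theta> [y < k]\<close> into \<open>(\<theta> - s) - \<theta> [y \<ge> k]\<close>; translating by \<open>k\<close>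
  moves the interval \<open>[k, p)\<close> to \<open>[0, p - k)\<close>.
\<close>
lemma S_seq_up_walk:
  "up_walk (int (theta p k)) p q (int (theta p k) - int (k div gcd p k)) 0 (p - k)
     (\<lambda>x. - S_seq p q k ((x + k) mod p))"
proof -
  have shift: "(x + k) mod p < k \<longleftrightarrow> \<not> x < p - k" if "x < p" for x
  proof (cases "x < p - k")
    case False
    then have "(x + k) mod p = x + k - p" using that kp by (simp add: mod_if)
    then show ?thesis using False that kp by simp
  qed simp
  have step: "- S_seq p q k ((x + k + q) mod p) = - S_seq p q k ((x + k) mod p)
       + (int (theta p k) - int (k div gcd p k)) - int (theta p k) * of_bool (x < p - k)"
    if "x < p" for x
  proof -
    have "(x + k) mod p < p" using kp by simp
    moreover have "(x + k + q) mod p = ((x + k) mod p + q) mod p" by (simp add: mod_simps)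
    moreover have "of_bool ((x + k) mod p < k) = (1 - of_bool (x < p - k) :: int)"
      using shift[OF that] by simp
    ultimately show ?thesis
      using S_seq_q_step[of "(x + k) mod p"] by (simp only: right_diff_distrib) simp
  qed
  show ?thesis unfolding up_walk_def
  proof (intro conjI allI impI)
    fix x assume "x < p - q"
    then show "- S_seq p q k ((x + q + k) mod p) = - S_seq p q k ((x + k) mod p)
       + (int (theta p k) - int (k div gcd p k)) - int (theta p k) * of_bool (x < p - k)"
      using step[of x] by (simp add: add_ac)
  next
    fix x assume x: "x < q"
    then have "x + (p - q) + k + q = x + k + p" using qp by simp
    then have "(x + (p - q) + k + q) mod p = (x + k) mod p" by (simp only: mod_add_self2)
    then show "- S_seq p q k ((x + k) mod p) = - S_seq p q k ((x + (p - q) + k) mod p)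
       + (int (theta p k) - int (k div gcd p k)) + 0
       - int (theta p k) * of_bool (x + (p - q) < p - k)"
      using step[of "x + (p - q)"] x qp by simp
  qed
qed

lemma min_count_eq_card_maximizers:
  "min_count p q k = card (maximizers p (\<lambda>x. - S_seq p q k ((x + k) mod p)))"
proof -
  let ?g = "S_seq p q k"
  have p0: "0 < p" using kp by simp
  have mn: "Min (?g ` {..<p}) = 0" using is_seq_S_seq[OF p0, of q k] by (simp add: is_seq_def)
  have nonneg: "0 \<le> ?g x" if "x < p" for x
    using Min_le[of "?g ` {..<p}" "?g x"] that mn by simp
  have "0 \<in> ?g ` {..<p}" using Min_in[of "?g ` {..<p}"] mn p0 by auto
  then obtain x0 where x0: "x0 < p" "?g x0 = 0" by auto
  note bij = bij_betw_add_mod[of k p]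
  have img: "(\<lambda>x. (x + k) mod p) ` {..<p} = {..<p}" using bij by (rule bij_betw_imp_surj_on)
  have "{x. x < p \<and> ?g x = 0} = (\<lambda>x. (x + k) mod p) ` maximizers p (\<lambda>x. - ?g ((x + k) mod p))"
  proof (intro equalityI subsetI)
    fix y assume "y \<in> {x. x < p \<and> ?g x = 0}"
    then have "y \<in> (\<lambda>x. (x + k) mod p) ` {..<p}" "?g y = 0" unfolding img by simp_all
    then obtain x where x: "x < p" "y = (x + k) mod p" "?g y = 0" by blast
    then have "x \<in> maximizers p (\<lambda>x. - ?g ((x + k) mod p))"
      using nonneg p0 by (simp add: maximizers_def)
    then show "y \<in> (\<lambda>x. (x + k) mod p) ` maximizers p (\<lambda>x. - ?g ((x + k) mod p))"
      using x by blast
  next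
    fix y assume "y \<in> (\<lambda>x. (x + k) mod p) ` maximizers p (\<lambda>x. - ?g ((x + k) mod p))"
    then obtain x where x: "y = (x + k) mod p" "x < p"
      "\<And>z. z < p \<Longrightarrow> - ?g ((z + k) mod p) \<le> - ?g y" by (auto simp: maximizers_def)
    have "x0 \<in> (\<lambda>x. (x + k) mod p) ` {..<p}" unfolding img using x0 by simp
    then obtain z where "z < p" "x0 = (z + k) mod p" by blast
    then have "?g y \<le> 0" using x(3)[of z] x0 by simp
    moreover have "y < p" using x p0 by simp
    ultimately show "y \<in> {x. x < p \<and> ?g x = 0}" using nonneg[of y] by simp
  qed
  moreover have "inj_on (\<lambda>x. (x + k) mod p) (maximizers p (\<lambda>x. - ?g ((x + k) mod p)))"
    by (rule inj_on_subset[OF bij_betw_imp_inj_on[OF bij]]) (auto simp: maximizers_def)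
  ultimately show ?thesis unfolding min_count_def by (simp add: card_image)
qed

end

section \<open>The number of minima\<close>

text \<open>
  Successive remainders are coprime, so a remainder greater than 1 does not divide its predecessor,
  and the ceiling in the statement is the quotient plus 1.
\<close>
lemma euclid_rem_coprime_Suc:
  assumes "coprime P Q"
  shows "coprime (euclid_rem P Q j) (euclid_rem P Q (Suc j))"
  using assms
proof (induction j arbitrary: P Q)
  case 0
  then show ?case using gcd_red_nat[of P Q] by (simp add: coprime_iff_gcd_eq_1)
next
  case (Suc j)
  have "coprime Q (P mod Q)"
    using Suc.prems gcd_red_nat[of P Q] by (simp add: coprime_iff_gcd_eq_1)
  from Suc.IH[OF this] show ?case by (simp only: euclid_rem_Suc)
qed

lemma euclid_rem_decreasing:
  assumes "euclid_rem P Q j \<noteq> 0"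
  shows "euclid_rem P Q (Suc j) < euclid_rem P Q j"
  using assms by (cases j) simp_all

lemma ceiling_divide_not_dvd:
  fixes a b :: nat
  assumes "\<not> b dvd a" "0 < b"
  shows "\<lceil>real a / real b\<rceil> = int (a div b) + 1"
proof -
  have fl: "\<lfloor>real a / real b\<rfloor> = int (a div b)" by (rule floor_divide_of_nat_eq)
  have "real a / real b \<noteq> real_of_int \<lfloor>real a / real b\<rfloor>"
  proof
    assume "real a / real b = real_of_int \<lfloor>real a / real b\<rfloor>"
    then have "real a = real (a div b * b)"
      using assms(2) unfolding fl by (simp add: divide_eq_eq)
    then have "a = a div b * b" by (simp only: of_nat_eq_iff)
    then show False using assms(1) by (metis dvd_triv_right)
  qed
  then show ?thesis unfolding ceiling_altdef fl by simp
qed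

lemma ex1_iff_card_eq_1: "(\<exists>!x. P x) \<longleftrightarrow> card {x. P x} = 1"
proof
  assume "\<exists>!x. P x"
  then obtain x where x: "P x" "\<And>y. P y \<Longrightarrow> y = x" by blast
  then have "{x. P x} = {x}" by blast
  then show "card {x. P x} = 1" by simp
next
  assume "card {x. P x} = 1"
  then obtain x where "{x. P x} = {x}" by (rule card_1_singletonE)
  then have "P y \<longleftrightarrow> y = x" for y by (metis mem_Collect_eq singleton_iff)
  then show "\<exists>!x. P x" by (intro ex1I[of _ x]) simp_all
qed

theorem theorem1p7:
  fixes p q k :: nat
  assumes "0 < q" and "q < p" and "coprime p q" and "0 < k" and "k < p"
  shows "int (min_count p q k) =
           (\<Prod>j | 0 < j \<and> j < euclid_len p q \<and> theta p k dvd euclid_rem p q j.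
              \<lceil>real (euclid_rem p q (j - 1)) / real (euclid_rem p q j)\<rceil>)
       \<and> (\<Prod>j | 0 < j \<and> j < euclid_len p q \<and> theta p k dvd euclid_rem p q j.
              \<lceil>real (euclid_rem p q (j - 1)) / real (euclid_rem p q j)\<rceil>) =
           (\<Prod>j | 0 < j \<and> j < euclid_len p q \<and> theta p k dvd euclid_rem p q j.
              int (euclid_coeff p q (j + 1)) + 1)
       \<and> ((\<exists>!x. x < p \<and> S_seq p q k x = 0) \<longleftrightarrow> \<not> harmonic p q (theta p k))"
proof -
  define h where "h = theta p k"
  define s where "s = k div gcd p k"
  let ?J = "{j. 0 < j \<and> j < euclid_len p q \<and> h dvd euclid_rem p q j}"
  let ?F = "\<lambda>x. - S_seq p q k ((x + k) mod p)"
  have hp: "p = h * gcd p k" and sk: "k = s * gcd p k"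
    by (simp_all add: h_def theta_def s_def)
  have g0: "0 < gcd p k" using assms by simp
  have s0: "0 < s" using sk assms(4) by (metis gr0I mult_0)
  have sh: "s < h" using assms(5) g0 hp sk by (metis mult_less_cancel2)
  have cop_sh: "coprime h s"
    unfolding h_def s_def theta_def using assms by (intro div_gcd_coprime) simp
  have flux: "s * p = h * k" using hp sk by (metis mult.assoc mult.commute)
  have nq: "\<not> h dvd q"
  proof
    assume "h dvd q"
    moreover have "h dvd p" using hp by (metis dvd_triv_left)
    ultimately have "is_unit h" using assms(3) by (meson coprime_common_divisor)
    then show False using s0 sh by simp
  qed
  have "card (maximizers p ?F) = tie_weight h p q"
  proof (rule card_maximizers_walk[where k = "p - k", OF assms(3,2)])
    fix x assume "x dvd int h - int s" "x dvd (0::int)" "x dvd int h"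
    then have "x dvd int h - (int h - int s)" "x dvd int h" by (blast intro: dvd_diff)+
    then have "x dvd int s" by simp
    moreover have "coprime (int h) (int s)" using cop_sh by simp
    ultimately show "is_unit x"
      using \<open>x dvd int h\<close> coprime_common_divisor by blast
  next
    show "(int h - int s) * int p + 0 * int q = int h * int (p - k)"
      using flux assms(5) by (simp add: left_diff_distrib right_diff_distrib flip: of_nat_mult)
  next
    have "up_walk h p q (int h - int s) 0 (p - k) ?F"
      using S_seq_up_walk[OF assms] by (simp only: h_def s_def)
    then show "up_walk h p q (int h - int s) 0 (p - k) ?F \<and> 0 < int h - int s \<and>
        int h - int s < int h \<and> (0::int) \<le> 0 \<and> p - k \<le> p \<or>
      down_walk h p q (int h - int s) 0 (p - k) ?F \<and> (0::int) < 0 \<and> 0 < int h \<and> p - k < p"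
      using s0 sh by simp
  qed
  moreover have "{j. j < euclid_len p q \<and> h dvd euclid_rem p q j} = ?J"
  proof -
    have "0 < j" if "h dvd euclid_rem p q j" for j
      using that nq by (cases j) auto
    then show ?thesis by auto
  qed
  ultimately have count: "min_count p q k = (\<Prod>j\<in>?J. euclid_coeff p q (j + 1) + 1)"
    using min_count_eq_card_maximizers[OF assms] by (simp add: tie_weight_def)
  have factor: "\<lceil>real (euclid_rem p q (j - 1)) / real (euclid_rem p q j)\<rceil>
        = int (euclid_coeff p q (j + 1)) + 1 \<and> 0 < euclid_coeff p q (j + 1)"
    if jJ: "j \<in> ?J" for j
  proof -
    obtain i where j: "j = Suc i" using jJ by (cases j) auto
    let ?a = "euclid_rem p q i" and ?b = "euclid_rem p q (Suc i)"
    have "h dvd ?b" "Suc i < euclid_len p q" using jJ j by auto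
    then have a0: "?a \<noteq> 0" and b0: "?b \<noteq> 0"
      unfolding euclid_len_def by (blast dest: not_less_Least Suc_lessD)+
    have cop: "coprime ?a ?b" by (rule euclid_rem_coprime_Suc[OF assms(3)])
    have "\<not> ?b dvd ?a"
    proof
      assume "?b dvd ?a"
      then have "is_unit ?b" using cop by (meson coprime_common_divisor dvd_refl)
      then show False using \<open>h dvd ?b\<close> s0 sh by simp
    qed
    then have "\<lceil>real ?a / real ?b\<rceil> = int (?a div ?b) + 1"
      using b0 by (intro ceiling_divide_not_dvd) simp_all
    moreover have "?b < ?a" using a0 by (rule euclid_rem_decreasing)
    ultimately show ?thesis using b0 by (simp add: j div_greater_zero_iff)
  qed
  have ceilings: "(\<Prod>j\<in>?J. \<lceil>real (euclid_rem p q (j - 1)) / real (euclid_rem p q j)\<rceil>)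
      = (\<Prod>j\<in>?J. int (euclid_coeff p q (j + 1)) + 1)"
    using factor by (intro prod.cong) auto
  have "int (min_count p q k) = (\<Prod>j\<in>?J. int (euclid_coeff p q (j + 1)) + 1)"
    unfolding count by (simp add: add.commute)
  moreover have "(\<exists>!x. x < p \<and> S_seq p q k x = 0) \<longleftrightarrow> min_count p q k = 1"
    unfolding min_count_def by (rule ex1_iff_card_eq_1)
  moreover have "min_count p q k = 1 \<longleftrightarrow> ?J = {}"
  proof -
    have "min_count p q k = 1 \<longleftrightarrow> (\<forall>j\<in>?J. euclid_coeff p q (j + 1) + 1 = 1)"
      unfolding count by (intro prod_eq_1_iff) simp
    moreover have "0 < euclid_coeff p q (j + 1)" if "j \<in> ?J" for j using factor[OF that] by blast
    ultimately show ?thesis unfolding add_cancel_left_left by (metis all_not_in_conv neq0_conv)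
  qed
  moreover have "harmonic p q h \<longleftrightarrow> ?J \<noteq> {}"
  proof -
    have "h dvd p" using hp by (metis dvd_triv_left)
    then show ?thesis by (auto simp: harmonic_def)
  qed
  ultimately show ?thesis
    using ceilings unfolding h_def by simp
qed

end
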